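(* Let $F$ be a non-archimedean ordered field, $\mathcal{C}$ the set of all convex subgroups of $(F,+)$, and $Q=\{a+A: a\in F, A\in\mathcal{C}\}$ with operations $(a+A)+(b+B)=a+b+A+B$, $(a+A)(b+B)=ab+aB+bA+AB$, and order $\alpha\le\beta$ iff $(\forall x\in\alpha)(\exists y\in\beta)(x\le y)$. Then $(Q,+,\cdot,\le)$, with $e(a+A)=A$, $s(a+A)=-a+A$, and for $\alpha=a+A\notin\mathcal{C}$, $u(\alpha)=1+A/a$, $d(\alpha)=\frac1a+\frac{A}{a^2}$, is an ordered association.
   Context: A subset of $F$ is convex if it contains every element lying between two of its elements; sums/products of sets are elementwise, and the operations on $Q$ are independent of representatives. Write $x<y$ iff $x\le y$ and $x\ne y$. Assembly: a non-empty structure $(\mathcal{A},\ast)$ such that (1) $\ast$ is associative; (2) commutative; (3) for every $x$ there is $e$ with $x\ast e=x$ and such that $x\ast f=x$ implies $e\ast f=e$ (unique, denoted $e(x)$); (4) for every $x$ there is $s$ with $x\ast s=e(x)$ and $e(s)=e(x)$ (unique, denoted $s(x)$); (5) for all $x,y$, $e(x\ast y)=e(x)$ or $e(x\ast y)=e(y)$. Association: $(\mathcal{A},+,\cdot)$ with $(\mathcal{A},+)$ an assembly (operators $e,s$), $\mathcal{N}=\{x:x=e(x)\}$, $(\mathcal{A}\setminus\mathcal{N},\cdot)$ an assembly (operators $u,d$), and for all $x,y,z$: (1) $xy+xz=x(y+z)+e(x)y+e(x)z$; (2) $\exists w\,(e(x)y=e(w))$; (3) $e(xy)=e(x)y+e(y)x$;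 (4) if $x\ne e(x)$ then $e(u(x))=e(x)d(x)$; (5) $s(xy)=s(x)y$. Ordered association: an association $(\mathcal{A},+,\cdot)$ with a total order $\le$ such that for all $x,y,z$: (1) $x\le y\Rightarrow x+z\le y+z$; (2) $y+e(x)=e(x)\Rightarrow (y\le e(x)\wedge s(y)\le e(x))$; (3) $(e(x)<x\wedge y\le z)\Rightarrow xy\le xz$; (4) $(e(y)\le y\le z)\Rightarrow e(x)y\le e(x)z$. *)

theory Defs
  imports "HOL-Library.Set_Algebras"
begin

definition assembly_e :: "'a set \<Rightarrow> ('a \<Rightarrow> 'a \<Rightarrow> 'a) \<Rightarrow> 'a \<Rightarrow> 'a" where
  "assembly_e S f x = (THE e. e \<in> S \<and> f x e = x \<and> (\<forall>g\<in>S. f x g = x \<longrightarrow> f e g = e))"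

definition assembly_s :: "'a set \<Rightarrow> ('a \<Rightarrow> 'a \<Rightarrow> 'a) \<Rightarrow> 'a \<Rightarrow> 'a" where
  "assembly_s S f x = (THE s. s \<in> S \<and> f x s = assembly_e S f x \<and> assembly_e S f s = assembly_e S f x)"

locale assembly =
  fixes S :: "'a set" and f :: "'a \<Rightarrow> 'a \<Rightarrow> 'a"
  assumes nonempty: "S \<noteq> {}"
    and closed: "\<lbrakk>x \<in> S; y \<in> S\<rbrakk> \<Longrightarrow> f x y \<in> S"
    and assoc: "\<lbrakk>x \<in> S; y \<in> S; z \<in> S\<rbrakk> \<Longrightarrow> f (f x y) z = f x (f y z)"
    and commute: "\<lbrakk>x \<in> S; y \<in> S\<rbrakk> \<Longrightarrow> f x y = f y x"
    and ex_e: "x \<in> S \<Longrightarrow> \<exists>e\<in>S. f x e = x \<and> (\<forall>g\<in>S. f x g = x \<longrightarrow> f e g = e)"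
    and ex_s: "x \<in> S \<Longrightarrow> \<exists>s\<in>S. f x s = assembly_e S f x \<and> assembly_e S f s = assembly_e S f x"
    and e_op: "\<lbrakk>x \<in> S; y \<in> S\<rbrakk> \<Longrightarrow>
      assembly_e S f (f x y) = assembly_e S f x \<or> assembly_e S f (f x y) = assembly_e S f y"
begin

lemma e_eqI:
  assumes "x \<in> S" "e \<in> S" "f x e = x" "\<And>g. \<lbrakk>g \<in> S; f x g = x\<rbrakk> \<Longrightarrow> f e g = e"
  shows "assembly_e S f x = e"
  unfolding assembly_e_def
proof (rule the_equality)
  fix e' assume "e' \<in> S \<and> f x e' = x \<and> (\<forall>g\<in>S. f x g = x \<longrightarrow> f e' g = e')"
  hence "e' \<in> S" "f e' e = e'" "f e e' = e" using assms by auto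
  thus "e' = e" using commute[OF \<open>e' \<in> S\<close> assms(2)] by simp
qed (use assms in blast)

lemma e_props:
  assumes "x \<in> S"
  shows "assembly_e S f x \<in> S" and "f x (assembly_e S f x) = x"
proof -
  obtain e where e: "e \<in> S" "f x e = x" "\<forall>g\<in>S. f x g = x \<longrightarrow> f e g = e"
    using ex_e[OF assms] by blast
  hence "assembly_e S f x = e" by (intro e_eqI assms) auto
  thus "assembly_e S f x \<in> S" "f x (assembly_e S f x) = x" using e by auto
qed

lemma s_unique:
  assumes "x \<in> S" "s \<in> S" "t \<in> S"
    and "f x s = assembly_e S f x" "assembly_e S f s = assembly_e S f x"
    and "f x t = assembly_e S f x" "assembly_e S f t = assembly_e S f x"
  shows "s = t"
proof -
  have "s = f s (f x t)" using e_props(2)[OF assms(2)] assms(5,6) by simp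
  also have "\<dots> = f (f s x) t" using assoc assms(1-3) by simp
  also have "\<dots> = f t (f x s)" using commute closed assms(1-3) by simp
  also have "\<dots> = t" using e_props(2)[OF assms(3)] assms(4,7) by simp
  finally show ?thesis .
qed

lemma s_props:
  assumes "x \<in> S"
  shows "assembly_s S f x \<in> S" and "f x (assembly_s S f x) = assembly_e S f x"
    and "assembly_e S f (assembly_s S f x) = assembly_e S f x"
proof -
  have "\<exists>!s. s \<in> S \<and> f x s = assembly_e S f x \<and> assembly_e S f s = assembly_e S f x"
    using ex_s[OF assms] s_unique[OF assms] by blast
  from theI'[OF this] show "assembly_s S f x \<in> S" "f x (assembly_s S f x) = assembly_e S f x"
    "assembly_e S f (assembly_s S f x) = assembly_e S f x"
    unfolding assembly_s_def by blast+
qed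

end

definition neutrices :: "'a set \<Rightarrow> ('a \<Rightarrow> 'a \<Rightarrow> 'a) \<Rightarrow> 'a set" where
  "neutrices S pl = {x \<in> S. x = assembly_e S pl x}"

definition association_u :: "'a set \<Rightarrow> ('a \<Rightarrow> 'a \<Rightarrow> 'a) \<Rightarrow> ('a \<Rightarrow> 'a \<Rightarrow> 'a) \<Rightarrow> 'a \<Rightarrow> 'a" where
  "association_u S pl mu = assembly_e (S - neutrices S pl) mu"

definition association_d :: "'a set \<Rightarrow> ('a \<Rightarrow> 'a \<Rightarrow> 'a) \<Rightarrow> ('a \<Rightarrow> 'a \<Rightarrow> 'a) \<Rightarrow> 'a \<Rightarrow> 'a" where
  "association_d S pl mu = assembly_s (S - neutrices S pl) mu"

locale association =
  fixes S :: "'a set" and pl :: "'a \<Rightarrow> 'a \<Rightarrow> 'a" and mu :: "'a \<Rightarrow> 'a \<Rightarrow> 'a"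
  assumes add_assembly: "assembly S pl"
    and mult_closed: "\<lbrakk>x \<in> S; y \<in> S\<rbrakk> \<Longrightarrow> mu x y \<in> S"
    and mult_assembly: "assembly (S - neutrices S pl) mu"
    and distrib: "\<lbrakk>x \<in> S; y \<in> S; z \<in> S\<rbrakk> \<Longrightarrow>
      pl (mu x y) (mu x z) =
      pl (pl (mu x (pl y z)) (mu (assembly_e S pl x) y)) (mu (assembly_e S pl x) z)"
    and e_mult_is_e: "\<lbrakk>x \<in> S; y \<in> S\<rbrakk> \<Longrightarrow> \<exists>w\<in>S. mu (assembly_e S pl x) y = assembly_e S pl w"
    and e_mult: "\<lbrakk>x \<in> S; y \<in> S\<rbrakk> \<Longrightarrow>
      assembly_e S pl (mu x y) = pl (mu (assembly_e S pl x) y) (mu (assembly_e S pl y) x)"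
    and e_u: "\<lbrakk>x \<in> S; x \<noteq> assembly_e S pl x\<rbrakk> \<Longrightarrow>
      assembly_e S pl (association_u S pl mu x) = mu (assembly_e S pl x) (association_d S pl mu x)"
    and s_mult: "\<lbrakk>x \<in> S; y \<in> S\<rbrakk> \<Longrightarrow> assembly_s S pl (mu x y) = mu (assembly_s S pl x) y"

locale ordered_association = association S pl mu
  for S :: "'a set" and pl :: "'a \<Rightarrow> 'a \<Rightarrow> 'a" and mu :: "'a \<Rightarrow> 'a \<Rightarrow> 'a" +
  fixes le :: "'a \<Rightarrow> 'a \<Rightarrow> bool"
  assumes le_refl: "reflp_on S le"
    and le_trans: "transp_on S le"
    and le_antisym: "antisymp_on S le"
    and le_total: "totalp_on S le"
    and add_mono: "\<lbrakk>x \<in> S; y \<in> S; z \<in> S; le x y\<rbrakk> \<Longrightarrow> le (pl x z) (pl y z)"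
    and absorbed_le: "\<lbrakk>x \<in> S; y \<in> S; pl y (assembly_e S pl x) = assembly_e S pl x\<rbrakk> \<Longrightarrow>
      le y (assembly_e S pl x) \<and> le (assembly_s S pl y) (assembly_e S pl x)"
    and mult_mono: "\<lbrakk>x \<in> S; y \<in> S; z \<in> S; le (assembly_e S pl x) x; assembly_e S pl x \<noteq> x; le y z\<rbrakk> \<Longrightarrow>
      le (mu x y) (mu x z)"
    and e_mult_mono: "\<lbrakk>x \<in> S; y \<in> S; z \<in> S; le (assembly_e S pl y) y; le y z\<rbrakk> \<Longrightarrow>
      le (mu (assembly_e S pl x) y) (mu (assembly_e S pl x) z)"

definition convex_subgroups :: "'a::linordered_field set set" where
  "convex_subgroups = {A. 0 \<in> A \<and> (\<forall>x\<in>A. \<forall>y\<in>A. x + y \<in> A) \<and> (\<forall>x\<in>A. - x \<in> A) \<and>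
     (\<forall>x\<in>A. \<forall>y\<in>A. \<forall>z. x \<le> z \<and> z \<le> y \<longrightarrow> z \<in> A)}"

definition Q :: "'a::linordered_field set set" where
  "Q = {a +o A | a A. A \<in> convex_subgroups}"

text \<open>
  The operations are defined through representatives; \<open>THE\<close> is justified by the independence
  of representatives, which is recorded in the lemmas \<open>Q_plus_eq\<close> and \<open>Q_mult_eq\<close> below.
  Sums and products of sets are the elementwise ones.
\<close>

definition Q_plus :: "'a::linordered_field set \<Rightarrow> 'a set \<Rightarrow> 'a set" where
  "Q_plus \<alpha> \<beta> = (THE \<gamma>. \<exists>a A b B. A \<in> convex_subgroups \<and> B \<in> convex_subgroups \<and>
     \<alpha> = a +o A \<and> \<beta> = b +o B \<and> \<gamma> = (a + b) +o (A + B))"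

definition Q_mult :: "'a::linordered_field set \<Rightarrow> 'a set \<Rightarrow> 'a set" where
  "Q_mult \<alpha> \<beta> = (THE \<gamma>. \<exists>a A b B. A \<in> convex_subgroups \<and> B \<in> convex_subgroups \<and>
     \<alpha> = a +o A \<and> \<beta> = b +o B \<and> \<gamma> = (a * b) +o (a *o B + b *o A + A * B))"

definition Q_le :: "'a::linordered_field set \<Rightarrow> 'a set \<Rightarrow> bool" where
  "Q_le \<alpha> \<beta> \<longleftrightarrow> (\<forall>x\<in>\<alpha>. \<exists>y\<in>\<beta>. x \<le> y)"

lemma convex_subgroupsD:
  assumes "A \<in> convex_subgroups"
  shows "0 \<in> A" "\<And>x y. \<lbrakk>x \<in> A; y \<in> A\<rbrakk> \<Longrightarrow> x + y \<in> A" "\<And>x. x \<in> A \<Longrightarrow> - x \<in> A"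
    "\<And>x y. \<lbrakk>x \<in> A; \<bar>y\<bar> \<le> \<bar>x\<bar>\<rbrakk> \<Longrightarrow> y \<in> A"
proof -
  show "0 \<in> A" "\<And>x y. \<lbrakk>x \<in> A; y \<in> A\<rbrakk> \<Longrightarrow> x + y \<in> A" and neg: "\<And>x. x \<in> A \<Longrightarrow> - x \<in> A"
    using assms unfolding convex_subgroups_def by blast+
  show "y \<in> A" if "x \<in> A" "\<bar>y\<bar> \<le> \<bar>x\<bar>" for x y
  proof -
    have "\<bar>x\<bar> \<in> A" "- \<bar>x\<bar> \<in> A" using neg \<open>x \<in> A\<close> by (auto simp: abs_if)
    moreover have "- \<bar>x\<bar> \<le> y" "y \<le> \<bar>x\<bar>" using that(2) by linarith+
    ultimately show ?thesis using assms unfolding convex_subgroups_def by blast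
  qed
qed

lemma coset_eqD:
  assumes "A \<in> convex_subgroups" "A' \<in> convex_subgroups" "a +o A = a' +o A'"
  shows "A = A'" "a' - a \<in> A"
proof -
  note D = convex_subgroupsD[OF assms(1)] and D' = convex_subgroupsD[OF assms(2)]
  have *: "x - a \<in> A \<longleftrightarrow> x - a' \<in> A'" for x
    using assms(3) by (metis set_minus_plus)
  have **: "a' - a \<in> A" using *[of a'] D'(1) by simp
  have ***: "a - a' \<in> A'" using *[of a] D(1) by simp
  have "x \<in> A'" if "x \<in> A" for x
    using D'(2)[of "x + (a - a')" "- (a - a')"] D'(3)[OF ***] *[of "x + a"] that
    by (simp add: algebra_simps)
  moreover have "x \<in> A" if "x \<in> A'" for x
    using D(2)[of "x + (a' - a)" "- (a' - a)"] D(3)[OF **] *[of "x + a'"] that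
    by (simp add: algebra_simps)
  ultimately show "A = A'" by blast
  show "a' - a \<in> A" by (fact **)
qed

lemma set_times_add_closed:
  assumes A: "A \<in> convex_subgroups" and B: "B \<in> convex_subgroups"
    and p: "p \<in> A * B" and q: "q \<in> A * B"
  shows "p + q \<in> A * B"
proof -
  note DA = convex_subgroupsD[OF A] and DB = convex_subgroupsD[OF B]
  obtain x y where xy: "x \<in> A" "y \<in> B" "p = x * y" using p by (auto simp: set_times_def)
  obtain x' y' where xy': "x' \<in> A" "y' \<in> B" "q = x' * y'" using q by (auto simp: set_times_def)
  define X where "X = max \<bar>x\<bar> \<bar>x'\<bar>"
  define Y where "Y = max \<bar>y\<bar> \<bar>y'\<bar>"
  have X: "X \<in> A" unfolding X_def max_def using DA(4)[of x "\<bar>x\<bar>"] DA(4)[of x' "\<bar>x'\<bar>"] xy xy' by auto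
  have Y: "Y \<in> B" unfolding Y_def max_def using DB(4)[of y "\<bar>y\<bar>"] DB(4)[of y' "\<bar>y'\<bar>"] xy xy' by auto
  have nn: "0 \<le> X" "0 \<le> Y" by (auto simp: X_def Y_def max_def)
  have "\<bar>p\<bar> \<le> X * Y" "\<bar>q\<bar> \<le> X * Y"
    unfolding xy(3) xy'(3) abs_mult by (auto simp: X_def Y_def intro!: Rings.mult_mono)
  hence le: "\<bar>p + q\<bar> \<le> X * (Y + Y)" unfolding distrib_left by linarith
  show ?thesis
  proof (cases "X = 0")
    case True
    hence "p + q = 0 * 0" using le by simp
    thus ?thesis using DA(1) DB(1) by (metis set_times_intro)
  next
    case False
    hence "X > 0" using nn by simp
    hence "\<bar>(p + q) / X\<bar> \<le> \<bar>Y + Y\<bar>" using le nn by (simp add: abs_divide divide_simps mult.commute)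
    hence "(p + q) / X \<in> B" using DB(4) DB(2)[OF Y Y] by blast
    hence "X * ((p + q) / X) \<in> A * B" using X by (intro set_times_intro)
    thus ?thesis using False by simp
  qed
qed

lemma Q_plus_eq:
  assumes "A \<in> convex_subgroups" "B \<in> convex_subgroups"
  shows "Q_plus (a +o A) (b +o B) = (a + b) +o (A + B)"
  unfolding Q_plus_def by (rule the_equality) (use assms in blast, auto simp: set_plus_rearrange[symmetric])

lemma mult_representatives_subset:
  assumes A: "A \<in> convex_subgroups" and B: "B \<in> convex_subgroups"
    and t: "a' - a \<in> A" and r: "b' - b \<in> B"
  shows "(a' * b') +o (a' *o B + b' *o A + A * B) \<subseteq> (a * b) +o (a *o B + b *o A + A * B)"
proof
  note DA = convex_subgroupsD[OF A] and DB = convex_subgroupsD[OF B]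
  fix v assume "v \<in> (a' * b') +o (a' *o B + b' *o A + A * B)"
  then obtain x y z where v: "x \<in> A" "y \<in> B" "z \<in> A * B" "v = a' * b' + (a' * y + b' * x + z)"
    by (auto simp: elt_set_plus_def elt_set_times_def set_plus_def)
  define t where "t = a' - a"
  define r where "r = b' - b"
  have tr: "t \<in> A" "r \<in> B" using t r by (auto simp: t_def r_def)
  have "v = a * b + (a * (y + r) + b * (x + t) + ((t * r + t * y) + (x * r + z)))"
    unfolding v(4) t_def r_def by (simp add: algebra_simps)
  moreover have "(t * r + t * y) + (x * r + z) \<in> A * B"
    using tr v by (intro set_times_add_closed[OF A B] set_times_intro) auto
  moreover have "y + r \<in> B" "x + t \<in> A" using DA(2) DB(2) tr v by auto
  ultimately show "v \<in> (a * b) +o (a *o B + b *o A + A * B)"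
    by (auto intro!: set_plus_intro2 set_plus_intro set_times_intro2)
qed

lemma Q_mult_eq:
  assumes A: "A \<in> convex_subgroups" and B: "B \<in> convex_subgroups"
  shows "Q_mult (a +o A) (b +o B) = (a * b) +o (a *o B + b *o A + A * B)"
  unfolding Q_mult_def
proof (rule the_equality)
  fix \<gamma> assume "\<exists>a' A' b' B'. A' \<in> convex_subgroups \<and> B' \<in> convex_subgroups \<and>
    a +o A = a' +o A' \<and> b +o B = b' +o B' \<and> \<gamma> = (a' * b') +o (a' *o B' + b' *o A' + A' * B')"
  then obtain a' A' b' B' where *: "A' \<in> convex_subgroups" "B' \<in> convex_subgroups"
    "a +o A = a' +o A'" "b +o B = b' +o B'" "\<gamma> = (a' * b') +o (a' *o B' + b' *o A' + A' * B')"
    by blast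
  have **: "A = A'" "B = B'" "a' - a \<in> A" "b' - b \<in> B"
    using coset_eqD[OF A *(1,3)] coset_eqD[OF B *(2,4)] by auto
  hence "a - a' \<in> A" "b - b' \<in> B"
    using convex_subgroupsD(3)[OF A] convex_subgroupsD(3)[OF B] by (metis minus_diff_eq)+
  thus "\<gamma> = (a * b) +o (a *o B + b *o A + A * B)"
    unfolding *(5) **(1,2)[symmetric]
    using mult_representatives_subset[OF A B] **(3,4) by (intro equalityI) auto
qed (use assms in blast)

end

theory Submission
  imports Defs
begin

text \<open>
  The convex subgroups form a chain, so the sum of two of them is the larger one. If \<open>a \<notin> A\<close>, then
  every element of \<open>a + A\<close> differs from \<open>a\<close> by a factor between 1/2 and 2; consequently the
  representative-wise product is the elementwise product of sets, and associativity, commutativity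
  and monotonicity descend from the field. The elements of \<open>Q\<close> outside \<open>\<C>\<close> are the sets
  \<open>a (1 + M)\<close> with \<open>a \<noteq> 0\<close> and \<open>1 \<notin> M\<close>, and
  \<open>a (1 + M) \<cdot> b (1 + N) = a b (1 + (M + N))\<close>, from which the multiplicative assembly is read off:
  \<open>u (a (1 + M)) = 1 + M\<close> and \<open>d (a (1 + M)) = a\<inverse> (1 + M)\<close>.
\<close>

section \<open>Convex subgroups\<close>

text \<open>Closure under passing to smaller absolute values gives negation and convexity at once:
  an element between \<open>x\<close> and \<open>y\<close> is bounded in absolute value by one of
  them.\<close>

lemma convex_subgroupsI:
  fixes A :: "'a::linordered_field set"
  assumes "0 \<in> A" and "\<And>x y. \<lbrakk>x \<in> A; y \<in> A\<rbrakk> \<Longrightarrow> x + y \<in> A"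
    and solid: "\<And>x y. \<lbrakk>x \<in> A; \<bar>y\<bar> \<le> \<bar>x\<bar>\<rbrakk> \<Longrightarrow> y \<in> A"
  shows "A \<in> convex_subgroups"
proof -
  have "z \<in> A" if "x \<in> A" "y \<in> A" "x \<le> z" "z \<le> y" for x y z
  proof (cases "\<bar>z\<bar> \<le> \<bar>x\<bar>")
    case False
    hence "\<bar>z\<bar> \<le> \<bar>y\<bar>" using that by linarith
    thus ?thesis using solid that by blast
  qed (use solid that in blast)
  moreover have "- x \<in> A" if "x \<in> A" for x using solid[OF that, of "- x"] by simp
  ultimately show ?thesis using assms(1,2) unfolding convex_subgroups_def by blast
qed

lemma convex_subgroups_diff:
  assumes "A \<in> convex_subgroups" "x \<in> A" "y \<in> A"
  shows "x - y \<in> A"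
  using convex_subgroupsD(2)[OF assms(1,2) convex_subgroupsD(3)[OF assms(1,3)]] by simp

lemma convex_subgroups_between:
  assumes "A \<in> convex_subgroups" "x \<in> A" "y \<in> A" "x \<le> z" "z \<le> y"
  shows "z \<in> A"
  using assms unfolding convex_subgroups_def by blast

text \<open>Of an element outside \<open>B\<close> and one outside \<open>A\<close>, the one of
  smaller absolute value would lie in both subgroups.\<close>

lemma convex_subgroups_linear:
  assumes "A \<in> convex_subgroups" "B \<in> convex_subgroups"
  shows "A \<subseteq> B \<or> B \<subseteq> A"
proof (rule ccontr)
  assume "\<not> ?thesis"
  then obtain x y where "x \<in> A" "x \<notin> B" "y \<in> B" "y \<notin> A" by blast
  moreover have "\<bar>x\<bar> \<le> \<bar>y\<bar> \<or> \<bar>y\<bar> \<le> \<bar>x\<bar>" by linarith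
  ultimately show False using convex_subgroupsD(4) assms by blast
qed

lemma convex_subgroups_plus_absorb:
  assumes "A \<subseteq> B" "A \<in> convex_subgroups" "B \<in> convex_subgroups"
  shows "A + B = B" "B + A = B"
proof -
  have "B \<subseteq> A + B"
    using set_plus_intro[OF convex_subgroupsD(1)[OF assms(2)], of _ B] by auto
  moreover have "A + B \<subseteq> B"
    using assms convex_subgroupsD(2)[OF assms(3)] by (auto simp: set_plus_def)
  ultimately show "A + B = B" by blast
  thus "B + A = B" by (simp add: add.commute)
qed

lemma convex_subgroups_plus_cases:
  assumes "A \<in> convex_subgroups" "B \<in> convex_subgroups"
  obtains "A \<subseteq> B" "A + B = B" | "B \<subseteq> A" "A + B = A"
  using convex_subgroups_linear[OF assms] convex_subgroups_plus_absorb(1)[OF _ assms]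
    convex_subgroups_plus_absorb(2)[OF _ assms(2,1)] by blast

lemma convex_subgroups_plus:
  assumes "A \<in> convex_subgroups" "B \<in> convex_subgroups"
  shows "A + B \<in> convex_subgroups"
  using convex_subgroups_plus_cases[OF assms] assms by metis

lemma convex_subgroups_plus_eqD:
  assumes "A \<in> convex_subgroups" "A + B = A"
  shows "B \<subseteq> A"
  using set_plus_intro[OF convex_subgroupsD(1)[OF assms(1)], of _ B] assms(2) by auto

lemma convex_subgroups_zero: "{0} \<in> convex_subgroups"
  by (rule convex_subgroupsI) auto

text \<open>For a smaller element \<open>q\<close> of a product \<open>x * y\<close>, keep the first
  factor \<open>x\<close>; the second becomes \<open>q / x\<close>, which is bounded by
  \<open>y\<close>.\<close>

lemma convex_subgroups_times:
  fixes A B :: "'a::linordered_field set"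
  assumes A: "A \<in> convex_subgroups" and B: "B \<in> convex_subgroups"
  shows "A * B \<in> convex_subgroups"
proof (rule convex_subgroupsI)
  note DA = convex_subgroupsD[OF A] and DB = convex_subgroupsD[OF B]
  show zero: "0 \<in> A * B" using set_times_intro[OF DA(1) DB(1)] by simp
  show "x + y \<in> A * B" if "x \<in> A * B" "y \<in> A * B" for x y
    using set_times_add_closed[OF A B that] .
  show "q \<in> A * B" if p: "p \<in> A * B" and le: "\<bar>q\<bar> \<le> \<bar>p\<bar>" for p q
  proof -
    obtain x y where xy: "x \<in> A" "y \<in> B" "p = x * y" using p by (auto simp: set_times_def)
    show ?thesis
    proof (cases "x = 0")
      case True
      thus ?thesis using le xy zero by simp
    next
      case False
      hence "\<bar>q / x\<bar> \<le> \<bar>y\<bar>" using le xy by (simp add: abs_mult abs_divide divide_simps mult.commute)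
      hence "q / x \<in> B" using DB(4) xy by blast
      hence "x * (q / x) \<in> A * B" using xy by (intro set_times_intro)
      thus ?thesis using False by simp
    qed
  qed
qed

lemma mem_scale_iff:
  fixes c :: "'a::field"
  assumes "c \<noteq> 0"
  shows "x \<in> c *o A \<longleftrightarrow> x / c \<in> A"
proof
  assume "x / c \<in> A"
  thus "x \<in> c *o A" using set_times_intro2[of "x / c" A c] assms by simp
qed (use assms in \<open>auto simp: elt_set_times_def\<close>)

lemma convex_subgroups_scale:
  fixes A :: "'a::linordered_field set"
  assumes "A \<in> convex_subgroups"
  shows "c *o A \<in> convex_subgroups"
proof (cases "c = 0")
  case True
  hence "c *o A = {0}" using convex_subgroupsD(1)[OF assms] by (auto simp: elt_set_times_def)
  thus ?thesis using convex_subgroups_zero by simp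
next
  case False
  note D = convex_subgroupsD[OF assms]
  show ?thesis
  proof (rule convex_subgroupsI, unfold mem_scale_iff[OF False])
    show "y / c \<in> A" if "x / c \<in> A" "\<bar>y\<bar> \<le> \<bar>x\<bar>" for x y
      using D(4)[OF that(1), of "y / c"] that(2) False by (simp add: abs_divide divide_right_mono)
  qed (use D in \<open>simp_all add: add_divide_distrib\<close>)
qed

text \<open>By linearity one of \<open>B\<close>, \<open>C\<close> absorbs the other, and
  multiplication by \<open>A\<close> preserves the inclusion, so the same absorption happens on the
  right.\<close>

lemma convex_subgroups_distrib:
  assumes "A \<in> convex_subgroups" "B \<in> convex_subgroups" "C \<in> convex_subgroups"
  shows "A * (B + C) = A * B + A * C"
  using convex_subgroups_plus_cases[OF assms(2,3)]
proof cases
  case 1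
  hence "A * B \<subseteq> A * C" by (intro set_times_mono2) auto
  thus ?thesis using 1 convex_subgroups_plus_absorb convex_subgroups_times assms by metis
next
  case 2
  hence "A * C \<subseteq> A * B" by (intro set_times_mono2) auto
  thus ?thesis using 2 convex_subgroups_plus_absorb convex_subgroups_times assms by metis
qed

section \<open>Elements outside a convex subgroup and multiplication by bounded factors\<close>

lemma abs_less_of_notin:
  fixes A :: "'a::linordered_field set"
  assumes "A \<in> convex_subgroups" "a \<notin> A" "s \<in> A"
  shows "\<bar>s\<bar> < \<bar>a\<bar>" "\<bar>a\<bar> < 2 * \<bar>a + s\<bar>"
proof -
  note D = convex_subgroupsD[OF assms(1)]
  show "\<bar>s\<bar> < \<bar>a\<bar>" using D(4)[OF assms(3), of a] assms(2) by force
  \<comment> \<open>Doubling stays inside \<open>A\<close>, so even \<open>2 * \<bar>s\<bar>\<close>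
    is below \<open>\<bar>a\<bar>\<close>; this is the source of the factor 2.\<close>
  have "\<bar>s + s\<bar> < \<bar>a\<bar>" using D(4)[OF D(2)[OF assms(3,3)], of a] assms(2) by force
  hence "2 * \<bar>s\<bar> < \<bar>a\<bar>" by simp
  moreover have "\<bar>a\<bar> \<le> \<bar>a + s\<bar> + \<bar>s\<bar>" by linarith
  moreover have "q < 2 * r" if "2 * p < q" "q \<le> r + p" for p q r :: 'a using that by linarith
  ultimately show "\<bar>a\<bar> < 2 * \<bar>a + s\<bar>" by blast
qed

lemma convex_subgroups_mult_bounded:
  fixes A :: "'a::linordered_field set"
  assumes "A \<in> convex_subgroups" "x \<in> A" "\<bar>r\<bar> \<le> 2"
  shows "r * x \<in> A"
proof -
  have "\<bar>r * x\<bar> \<le> \<bar>x + x\<bar>"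
    using mult_right_mono[OF assms(3), of "\<bar>x\<bar>"] by (simp add: abs_mult)
  thus ?thesis using convex_subgroupsD(4,2) assms by blast
qed

section \<open>Cosets\<close>

lemma mem_coset_iff:
  fixes a :: "'a::ab_group_add"
  shows "x \<in> a +o A \<longleftrightarrow> x - a \<in> A"
  by (rule set_minus_plus[symmetric])

lemma coset_eqI:
  assumes "A \<in> convex_subgroups" "b - a \<in> A"
  shows "a +o A = b +o A"
proof -
  have "x - a \<in> A \<longleftrightarrow> x - b \<in> A" for x
    using convex_subgroupsD(2)[OF assms(1) _ assms(2), of "x - b"]
      convex_subgroups_diff[OF assms(1) _ assms(2), of "x - a"] by auto
  thus ?thesis by (auto simp: mem_coset_iff)
qed

lemma coset_eq_iff:
  assumes "A \<in> convex_subgroups" "B \<in> convex_subgroups"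
  shows "a +o A = b +o B \<longleftrightarrow> A = B \<and> b - a \<in> A"
  using coset_eqD[OF assms] coset_eqI assms by metis

lemma coset_eq_subgroup_iff:
  assumes "A \<in> convex_subgroups" "B \<in> convex_subgroups"
  shows "a +o A = B \<longleftrightarrow> A = B \<and> a \<in> A"
proof -
  have "0 - a \<in> A \<longleftrightarrow> a \<in> A"
    using convex_subgroupsD(3)[OF assms(1), of a] convex_subgroupsD(3)[OF assms(1), of "- a"] by auto
  thus ?thesis using coset_eq_iff[OF assms, of a 0] by simp
qed

lemma coset_in_convex_subgroups_iff:
  assumes "A \<in> convex_subgroups"
  shows "a +o A \<in> convex_subgroups \<longleftrightarrow> a \<in> A"
  using coset_eq_subgroup_iff assms by metis

section \<open>Membership in \<open>Q\<close> and the operations as elementwise sums and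
  products\<close>

lemma coset_in_Q: "A \<in> convex_subgroups \<Longrightarrow> a +o A \<in> Q"
  unfolding Q_def by blast

lemma convex_subgroups_in_Q: "A \<in> convex_subgroups \<Longrightarrow> A \<in> Q"
  using coset_in_Q[of A 0] by simp

lemma Q_cases:
  assumes "x \<in> Q"
  obtains a A where "A \<in> convex_subgroups" "x = a +o A"
  using assms unfolding Q_def by blast

text \<open>Associativity and commutativity are inherited from elementwise addition through this
  identity.\<close>

lemma Q_plus_eq_set_plus:
  assumes "x \<in> Q" "y \<in> Q"
  shows "Q_plus x y = x + y"
  using assms by (auto elim!: Q_cases simp: Q_plus_eq set_plus_rearrange)

lemma Q_plus_closed: "\<lbrakk>x \<in> Q; y \<in> Q\<rbrakk> \<Longrightarrow> Q_plus x y \<in> Q"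
  by (auto elim!: Q_cases simp: Q_plus_eq intro!: coset_in_Q convex_subgroups_plus)

text \<open>
  The bounded factors \<open>a / (a + s)\<close> and \<open>s' / a\<close> let both \<open>a B\<close> and \<open>A B\<close> be absorbed into the
  second factor of a product \<open>(a + s) (b + t)\<close>.
\<close>

lemma coset_times_superset:
  fixes A B :: "'a::linordered_field set"
  assumes A: "A \<in> convex_subgroups" and B: "B \<in> convex_subgroups" and a: "a \<notin> A"
  shows "(a * b) +o (a *o B + b *o A + A * B) \<subseteq> (a +o A) * (b +o B)"
proof
  fix v assume "v \<in> (a * b) +o (a *o B + b *o A + A * B)"
  then obtain s t s' t' where st: "s \<in> A" "t \<in> B" "s' \<in> A" "t' \<in> B"
    and v: "v = a * b + (a * t + b * s + s' * t')"
    by (auto simp: elt_set_plus_def elt_set_times_def set_plus_def set_times_def)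
  have a0: "a \<noteq> 0" using a convex_subgroupsD(1)[OF A] by auto
  have as: "\<bar>a\<bar> < 2 * \<bar>a + s\<bar>" "\<bar>s'\<bar> < \<bar>a\<bar>" using abs_less_of_notin[OF A a] st by auto
  hence as0: "a + s \<noteq> 0" by auto
  \<comment> \<open>The first factor is to be \<open>a + s\<close>. Here \<open>t1\<close> is chosen
    so that \<open>a * t1 = a * t + s' * t'\<close>; solving for the second factor then gives
    \<open>b + (a / (a + s)) * t1\<close>.\<close>
  define t1 where "t1 = t + (s' / a) * t'"
  have "\<bar>s' / a\<bar> \<le> 1" using as a0 by (simp add: abs_divide)
  hence "(s' / a) * t' \<in> B" using st by (intro convex_subgroups_mult_bounded[OF B]) auto
  hence "t1 \<in> B" unfolding t1_def using convex_subgroupsD(2)[OF B] st by blast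
  moreover have "\<bar>a / (a + s)\<bar> \<le> 2" using as as0 by (simp add: abs_divide divide_simps)
  ultimately have t2: "(a / (a + s)) * t1 \<in> B" by (intro convex_subgroups_mult_bounded[OF B])
  have "(a + s) * ((a / (a + s)) * t1) = a * t1" using as0 by simp
  moreover have "a * t1 = a * t + s' * t'" using a0 by (simp add: t1_def distrib_left)
  ultimately have "v = (a + s) * (b + (a / (a + s)) * t1)"
    unfolding v distrib_left[of "a + s"] by (simp add: algebra_simps)
  thus "v \<in> (a +o A) * (b +o B)" using st t2 by (auto intro!: set_times_intro set_plus_intro2)
qed

text \<open>One inclusion is the expansion of \<open>(a + s) * (b + t)\<close>. The other follows
  from \<open>coset_times_superset\<close>, up to exchanging the factors, unless both cosets are
  subgroups.\<close>

lemma coset_times: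
  fixes A B :: "'a::linordered_field set"
  assumes A: "A \<in> convex_subgroups" and B: "B \<in> convex_subgroups"
  shows "(a +o A) * (b +o B) = (a * b) +o (a *o B + b *o A + A * B)"
proof
  show "(a +o A) * (b +o B) \<subseteq> (a * b) +o (a *o B + b *o A + A * B)"
  proof
    fix v assume "v \<in> (a +o A) * (b +o B)"
    then obtain s t where st: "s \<in> A" "t \<in> B" "v = (a + s) * (b + t)"
      by (auto simp: elt_set_plus_def set_times_def)
    hence "v = a * b + (a * t + b * s + s * t)" by (simp add: algebra_simps)
    thus "v \<in> (a * b) +o (a *o B + b *o A + A * B)"
      using st by (auto intro!: set_plus_intro2 set_plus_intro set_times_intro2 set_times_intro)
  qed
  show "(a * b) +o (a *o B + b *o A + A * B) \<subseteq> (a +o A) * (b +o B)"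
  proof (cases "a \<in> A \<and> b \<in> B")
    case True
    \<comment> \<open>Two subgroups: with both representatives replaced by 0, the right-hand side
      collapses to \<open>A * B\<close>.\<close>
    have "a +o A = 0 +o A" "b +o B = 0 +o B"
      using True A B by (auto simp: coset_eq_subgroup_iff)
    moreover have "(a * b) +o (a *o B + b *o A + A * B) \<subseteq> (0 * 0) +o (0 *o B + 0 *o A + A * B)"
      using True by (intro mult_representatives_subset[OF A B]) auto
    moreover have "(0 * 0) +o (0 *o B + 0 *o A + A * B) \<subseteq> A * B"
      by (auto simp: elt_set_times_def set_plus_def)
    ultimately show ?thesis by simp
  next
    case False
    thus ?thesis
      using coset_times_superset[OF A B, of a b] coset_times_superset[OF B A, of b a]
      by (auto simp: ac_simps)
  qed
qed

lemma Q_mult_eq_set_times: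
  assumes "x \<in> Q" "y \<in> Q"
  shows "Q_mult x y = x * y"
  using assms by (auto elim!: Q_cases simp: Q_mult_eq coset_times)

lemma Q_mult_closed: "\<lbrakk>x \<in> Q; y \<in> Q\<rbrakk> \<Longrightarrow> Q_mult x y \<in> Q"
  by (auto elim!: Q_cases simp: Q_mult_eq
      intro!: coset_in_Q convex_subgroups_plus convex_subgroups_times convex_subgroups_scale)

text \<open>The representative 0 of \<open>A\<close> kills two of the four terms. Products of this
  kind are the \<open>e(x) y\<close> of the association axioms.\<close>

lemma subgroup_times_coset:
  fixes A B :: "'a::linordered_field set"
  assumes A: "A \<in> convex_subgroups" and B: "B \<in> convex_subgroups"
  shows "Q_mult A (b +o B) = b *o A + A * B"
proof -
  have "0 *o B = 0" using convex_subgroupsD(1)[OF B] by (auto simp: elt_set_times_def)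
  thus ?thesis using Q_mult_eq[OF A B, of 0 b] by simp
qed

section \<open>The additive assembly\<close>

text \<open>A version of \<open>e_eqI\<close> that asks for commutativity instead of a full
  assembly, so that \<open>assembly_e\<close> can be computed while the assembly axioms are still
  being verified.\<close>

lemma assembly_e_eqI:
  assumes "\<And>x y. \<lbrakk>x \<in> S; y \<in> S\<rbrakk> \<Longrightarrow> f x y = f y x"
    and "e \<in> S" "f x e = x" "\<And>g. \<lbrakk>g \<in> S; f x g = x\<rbrakk> \<Longrightarrow> f e g = e"
  shows "assembly_e S f x = e"
  unfolding assembly_e_def
proof (rule the_equality)
  fix e' assume "e' \<in> S \<and> f x e' = x \<and> (\<forall>g\<in>S. f x g = x \<longrightarrow> f e' g = e')"
  hence "e' \<in> S" "f e' e = e'" "f e e' = e" using assms(2-4) by blast+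
  thus "e' = e" using assms(1)[OF \<open>e' \<in> S\<close> assms(2)] by simp
qed (use assms in blast)

lemma (in assembly) s_eqI:
  assumes "x \<in> S" "s \<in> S" "f x s = assembly_e S f x" "assembly_e S f s = assembly_e S f x"
  shows "assembly_s S f x = s"
  using s_unique[OF assms(1) s_props(1)[OF assms(1)] assms(2) s_props(2,3)[OF assms(1)]] assms by blast

text \<open>Being absorbed by \<open>a +o A\<close> does not depend on \<open>a\<close>. Hence
  whatever is neutral for the coset is already absorbed by \<open>A\<close>, which makes
  \<open>A\<close> the value of \<open>e\<close>.\<close>

lemma Q_plus_eq_self_iff:
  fixes A B :: "'a::linordered_field set"
  assumes A: "A \<in> convex_subgroups" and B: "B \<in> convex_subgroups"
  shows "Q_plus (a +o A) (b +o B) = a +o A \<longleftrightarrow> B \<subseteq> A \<and> b \<in> A"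
proof
  assume "Q_plus (a +o A) (b +o B) = a +o A"
  hence "A + B = A" "- b \<in> A"
    using A B by (auto simp: Q_plus_eq coset_eq_iff convex_subgroups_plus)
  thus "B \<subseteq> A \<and> b \<in> A" using convex_subgroups_plus_eqD[OF A] convex_subgroupsD(3)[OF A, of "- b"] by auto
next
  assume "B \<subseteq> A \<and> b \<in> A"
  thus "Q_plus (a +o A) (b +o B) = a +o A"
    using A B convex_subgroupsD(3)[OF A, of b]
    by (auto simp: Q_plus_eq convex_subgroups_plus_absorb coset_eq_iff)
qed

lemma Q_plus_neutral:
  fixes A :: "'a::linordered_field set"
  assumes A: "A \<in> convex_subgroups"
  shows "Q_plus (a +o A) A = a +o A"
    and "\<lbrakk>g \<in> Q; Q_plus (a +o A) g = a +o A\<rbrakk> \<Longrightarrow> Q_plus A g = A"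
proof -
  show "Q_plus (a +o A) A = a +o A"
    using Q_plus_eq_self_iff[OF A A, of a 0] convex_subgroupsD(1)[OF A] by simp
  assume g: "g \<in> Q" "Q_plus (a +o A) g = a +o A"
  obtain b B where B: "B \<in> convex_subgroups" "g = b +o B" using g(1) by (rule Q_cases)
  show "Q_plus A g = A"
    using g(2) B(2) Q_plus_eq_self_iff[OF A B(1), of 0 b]
      Q_plus_eq_self_iff[OF A B(1), of a b] by simp
qed

lemma Q_e:
  fixes A :: "'a::linordered_field set"
  assumes A: "A \<in> convex_subgroups"
  shows "assembly_e Q Q_plus (a +o A) = A"
proof (rule assembly_e_eqI)
  show "Q_plus x y = Q_plus y x" if "x \<in> Q" "y \<in> Q" for x y :: "'a set"
    using that by (simp add: Q_plus_eq_set_plus add.commute)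
qed (use convex_subgroups_in_Q[OF A] Q_plus_neutral[OF A] in auto)

lemma Q_e_subgroup:
  assumes "A \<in> convex_subgroups"
  shows "assembly_e Q Q_plus A = A"
  using Q_e[OF assms, of 0] by simp

lemma Q_plus_uminus:
  assumes "A \<in> convex_subgroups"
  shows "Q_plus (a +o A) ((- a) +o A) = A"
  using assms by (simp add: Q_plus_eq convex_subgroups_plus_absorb)

lemma Q_plus_assembly: "assembly (Q :: 'a::linordered_field set set) Q_plus"
proof
  show "(Q :: 'a set set) \<noteq> {}" using convex_subgroups_in_Q[OF convex_subgroups_zero] by blast
next
  fix x y z :: "'a set" assume Q: "x \<in> Q" "y \<in> Q"
  show "Q_plus x y \<in> Q" using Q by (rule Q_plus_closed)
  show "Q_plus x y = Q_plus y x" using Q by (simp add: Q_plus_eq_set_plus add.commute)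
  show "Q_plus (Q_plus x y) z = Q_plus x (Q_plus y z)" if "z \<in> Q"
    using Q that Q_plus_closed[of x y] Q_plus_closed[of y z]
    by (simp add: Q_plus_eq_set_plus add.assoc)
  obtain a A where A: "A \<in> convex_subgroups" "x = a +o A" using Q(1) by (rule Q_cases)
  obtain b B where B: "B \<in> convex_subgroups" "y = b +o B" using Q(2) by (rule Q_cases)
  show "assembly_e Q Q_plus (Q_plus x y) = assembly_e Q Q_plus x \<or>
      assembly_e Q Q_plus (Q_plus x y) = assembly_e Q Q_plus y"
    using A B convex_subgroups_plus_cases[OF A(1) B(1)]
    by (metis Q_e Q_plus_eq)
next
  fix x :: "'a set" assume "x \<in> Q"
  then obtain a A where A: "A \<in> convex_subgroups" "x = a +o A" by (rule Q_cases)
  show "\<exists>e\<in>Q. Q_plus x e = x \<and> (\<forall>g\<in>Q. Q_plus x g = x \<longrightarrow> Q_plus e g = e)"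
    using convex_subgroups_in_Q[OF A(1)] Q_plus_neutral[OF A(1)] A(2) by blast
  show "\<exists>s\<in>Q. Q_plus x s = assembly_e Q Q_plus x \<and> assembly_e Q Q_plus s = assembly_e Q Q_plus x"
    using Q_plus_uminus[OF A(1)] coset_in_Q[OF A(1)] Q_e[OF A(1)] A(2) by metis
qed

lemma Q_s:
  assumes A: "A \<in> convex_subgroups"
  shows "assembly_s Q Q_plus (a +o A) = (- a) +o A"
  using assms
  by (intro assembly.s_eqI[OF Q_plus_assembly]) (auto simp: Q_e Q_plus_uminus intro: coset_in_Q)

text \<open>Since \<open>e\<close> sends \<open>a +o A\<close> to \<open>A\<close>, its fixed points
  are the cosets equal to their own subgroup. This identifies the carrier of the multiplicative
  assembly.\<close>

lemma neutrices_Q: "neutrices Q Q_plus = convex_subgroups"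
proof -
  have "x = assembly_e Q Q_plus x \<longleftrightarrow> x \<in> convex_subgroups" if "x \<in> Q" for x :: "'a set"
  proof -
    obtain a A where A: "A \<in> convex_subgroups" "x = a +o A" using \<open>x \<in> Q\<close> by (rule Q_cases)
    show ?thesis
      unfolding A(2) Q_e[OF A(1)] coset_eq_subgroup_iff[OF A(1) A(1)]
        coset_in_convex_subgroups_iff[OF A(1)] by simp
  qed
  thus ?thesis using convex_subgroups_in_Q by (auto simp: neutrices_def)
qed

section \<open>The multiplicative assembly\<close>

lemma scale_coset:
  fixes c :: "'a::comm_ring_1"
  shows "c *o (a +o A) = (c * a) +o (c *o A)"
  by (rule set_times_plus_distribs)

lemma scale_unit_in_zeroless:
  fixes M :: "'a::linordered_field set"
  assumes "M \<in> convex_subgroups" "1 \<notin> M" "a \<noteq> 0"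
  shows "a *o (1 +o M) \<in> Q - convex_subgroups"
  using assms
  by (simp add: scale_coset coset_in_Q convex_subgroups_scale coset_in_convex_subgroups_iff mem_scale_iff)

text \<open>Dividing by \<open>a\<close> turns \<open>A\<close> into the relative part
  \<open>M\<close>, and \<open>a \<notin> A\<close> into \<open>1 \<notin> M\<close>.\<close>

lemma coset_eq_scale_unit:
  fixes A :: "'a::linordered_field set"
  assumes "A \<in> convex_subgroups" "a \<notin> A"
  shows "a \<noteq> 0" "1 \<notin> (1 / a) *o A" "a +o A = a *o (1 +o ((1 / a) *o A))"
proof -
  show a: "a \<noteq> 0" using assms convex_subgroupsD(1) by metis
  show "1 \<notin> (1 / a) *o A" using a assms by (simp add: mem_scale_iff)
  show "a +o A = a *o (1 +o ((1 / a) *o A))"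
    using a by (simp add: scale_coset set_times_rearrange2)
qed

lemma zeroless_cases:
  fixes x :: "'a::linordered_field set"
  assumes "x \<in> Q - convex_subgroups"
  obtains a M where "M \<in> convex_subgroups" "1 \<notin> M" "a \<noteq> 0" "x = a *o (1 +o M)"
proof -
  obtain a A where A: "A \<in> convex_subgroups" "x = a +o A" using assms by (blast elim: Q_cases)
  hence "a \<notin> A" using assms coset_in_convex_subgroups_iff by auto
  thus thesis using that coset_eq_scale_unit[OF A(1)] convex_subgroups_scale[OF A(1)] A(2) by metis
qed

text \<open>As 1 lies outside \<open>M\<close>, all elements of \<open>M\<close> have absolute value
  below 1; so \<open>M * N\<close> lies in \<open>N\<close> and the cross term is absorbed.\<close>

lemma unit_times_unit:
  fixes M N :: "'a::linordered_field set"
  assumes M: "M \<in> convex_subgroups" "1 \<notin> M" and N: "N \<in> convex_subgroups"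
  shows "(1 +o M) * (1 +o N) = 1 +o (M + N)"
proof -
  have "M * N \<subseteq> N"
  proof
    fix v assume "v \<in> M * N"
    then obtain m n where mn: "m \<in> M" "n \<in> N" "v = m * n" by (auto simp: set_times_def)
    moreover have "\<bar>m\<bar> < 1" using abs_less_of_notin(1)[OF M mn(1)] by simp
    ultimately show "v \<in> N" using convex_subgroups_mult_bounded[OF N] by simp
  qed
  hence "N + M * N = N" by (intro convex_subgroups_plus_absorb convex_subgroups_times M N)
  hence "N + M + M * N = M + N" by (metis add.commute add.left_commute)
  thus ?thesis using coset_times[OF M(1) N, of 1 1] by simp
qed

text \<open>Both \<open>g\<close> and \<open>1 / g\<close> are bounded by 2 in absolute value, and
  factors of that size map every convex subgroup into itself.\<close>

lemma scale_eq_self_of_unit: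
  fixes M N :: "'a::linordered_field set"
  assumes M: "M \<in> convex_subgroups" "1 \<notin> M" and g: "g \<in> 1 +o M" and N: "N \<in> convex_subgroups"
  shows "g *o N = N" "g \<noteq> 0"
proof -
  have m: "g - 1 \<in> M" using g by (simp add: mem_coset_iff)
  have lo: "1 < 2 * \<bar>g\<bar>" and "\<bar>g - 1\<bar> < 1" using abs_less_of_notin[OF M m] by auto
  thus g0: "g \<noteq> 0" by auto
  have hi: "\<bar>g\<bar> \<le> 2" using \<open>\<bar>g - 1\<bar> < 1\<close> by linarith
  have inv: "\<bar>1 / g\<bar> \<le> 2" using lo g0 by (simp add: abs_divide divide_simps)
  have "x / g \<in> N \<longleftrightarrow> x \<in> N" for x
    using convex_subgroups_mult_bounded[OF N _ hi, of "x / g"]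
      convex_subgroups_mult_bounded[OF N _ inv, of x] g0 by auto
  thus "g *o N = N" using mem_scale_iff[OF g0] by blast
qed

lemma scale_unit_eq_unit:
  fixes M :: "'a::linordered_field set"
  assumes M: "M \<in> convex_subgroups" "1 \<notin> M" and g: "g \<in> 1 +o M"
  shows "g *o (1 +o M) = 1 +o M"
  unfolding scale_coset scale_eq_self_of_unit(1)[OF M g M(1)]
  using coset_eqI[OF M(1), of g 1] g by (simp add: mem_coset_iff)

text \<open>Uniqueness of the normal form. With \<open>r = b / a\<close>, comparing
  \<open>r +o (r *o N)\<close> and \<open>1 +o M\<close> puts \<open>r\<close> in
  \<open>1 +o M\<close>; scaling by such an \<open>r\<close> fixes \<open>N\<close>.\<close>

lemma scale_unit_eqD:
  fixes M N :: "'a::linordered_field set"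
  assumes M: "M \<in> convex_subgroups" "1 \<notin> M" and N: "N \<in> convex_subgroups"
    and a: "a \<noteq> 0" and eq: "b *o (1 +o N) = a *o (1 +o M)"
  shows "N = M" "b / a \<in> 1 +o M"
proof -
  define r where "r = b / a"
  have "(1 / a) *o (b *o (1 +o N)) = (1 / a) *o (a *o (1 +o M))" using eq by simp
  hence "r +o (r *o N) = 1 +o M" using a by (simp add: r_def set_times_rearrange2 scale_coset)
  hence rN: "r *o N = M" "1 - r \<in> M"
    using N M by (auto simp: coset_eq_iff convex_subgroups_scale)
  hence r: "r \<in> 1 +o M" using convex_subgroupsD(3)[OF M(1), of "1 - r"] by (simp add: mem_coset_iff)
  thus "b / a \<in> 1 +o M" by (simp add: r_def)
  show "N = M" using scale_eq_self_of_unit(1)[OF M r N] rN by simp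
qed

lemma one_notin_plus:
  assumes "M \<in> convex_subgroups" "1 \<notin> M" "N \<in> convex_subgroups" "1 \<notin> N"
  shows "1 \<notin> M + N"
  using convex_subgroups_plus_cases[OF assms(1,3)] assms by metis

lemma Q_mult_scale_unit:
  fixes M N :: "'a::linordered_field set"
  assumes "M \<in> convex_subgroups" "1 \<notin> M" "a \<noteq> 0" "N \<in> convex_subgroups" "1 \<notin> N" "b \<noteq> 0"
  shows "Q_mult (a *o (1 +o M)) (b *o (1 +o N)) = (a * b) *o (1 +o (M + N))"
  using scale_unit_in_zeroless[OF assms(1-3)] scale_unit_in_zeroless[OF assms(4-6)] assms
  by (simp add: Q_mult_eq_set_times set_times_rearrange unit_times_unit)

text \<open>For the second claim write \<open>g = b *o (1 +o N)\<close>. Uniqueness of the normal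
  form forces \<open>M + N = M\<close> and \<open>b \<in> 1 +o M\<close>, conditions free of
  \<open>a\<close>, so \<open>1 +o M\<close> absorbs \<open>g\<close> as well.\<close>

lemma Q_mult_neutral:
  fixes M :: "'a::linordered_field set"
  assumes M: "M \<in> convex_subgroups" "1 \<notin> M" and a: "a \<noteq> 0"
  shows "Q_mult (a *o (1 +o M)) (1 +o M) = a *o (1 +o M)"
    and "\<lbrakk>g \<in> Q - convex_subgroups; Q_mult (a *o (1 +o M)) g = a *o (1 +o M)\<rbrakk> \<Longrightarrow>
      Q_mult (1 +o M) g = 1 +o M"
proof -
  show "Q_mult (a *o (1 +o M)) (1 +o M) = a *o (1 +o M)"
    using Q_mult_scale_unit[OF M a M, of 1] M by (simp add: convex_subgroups_plus_absorb)
  assume g: "g \<in> Q - convex_subgroups" "Q_mult (a *o (1 +o M)) g = a *o (1 +o M)"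
  obtain b N where N: "N \<in> convex_subgroups" "1 \<notin> N" "b \<noteq> 0" "g = b *o (1 +o N)"
    using g(1) by (rule zeroless_cases)
  have "(a * b) *o (1 +o (M + N)) = a *o (1 +o M)"
    using g(2) unfolding N(4) Q_mult_scale_unit[OF M a N(1-3)] .
  from scale_unit_eqD[OF M convex_subgroups_plus[OF M(1) N(1)] a this]
  have "M + N = M" "b \<in> 1 +o M" using a by auto
  thus "Q_mult (1 +o M) g = 1 +o M"
    using Q_mult_scale_unit[OF M one_neq_zero N(1-3)] N(4) scale_unit_eq_unit[OF M] by simp
qed

lemma Q_mult_commute: "\<lbrakk>x \<in> Q; y \<in> Q\<rbrakk> \<Longrightarrow> Q_mult x y = Q_mult y x"
  by (simp add: Q_mult_eq_set_times mult.commute)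

lemma Q_u_scale_unit:
  fixes M :: "'a::linordered_field set"
  assumes M: "M \<in> convex_subgroups" "1 \<notin> M" and a: "a \<noteq> 0"
  shows "assembly_e (Q - convex_subgroups) Q_mult (a *o (1 +o M)) = 1 +o M"
proof (rule assembly_e_eqI)
  show "1 +o M \<in> Q - convex_subgroups" using scale_unit_in_zeroless[OF M one_neq_zero] by simp
  show "Q_mult x y = Q_mult y x" if "x \<in> Q - convex_subgroups" "y \<in> Q - convex_subgroups"
    for x y :: "'a set" using that by (simp add: Q_mult_commute)
qed (fact Q_mult_neutral[OF M a])+

lemma Q_mult_inverse:
  fixes M :: "'a::linordered_field set"
  assumes "M \<in> convex_subgroups" "1 \<notin> M" "a \<noteq> 0"
  shows "Q_mult (a *o (1 +o M)) ((1 / a) *o (1 +o M)) = 1 +o M"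
  using assms by (simp add: Q_mult_scale_unit convex_subgroups_plus_absorb)

lemma Q_mult_assembly: "assembly (Q - convex_subgroups :: 'a::linordered_field set set) Q_mult"
proof
  show "(Q - convex_subgroups :: 'a set set) \<noteq> {}"
    using scale_unit_in_zeroless[OF convex_subgroups_zero, of 1] by auto
next
  fix x y z :: "'a set" assume x: "x \<in> Q - convex_subgroups" and y: "y \<in> Q - convex_subgroups"
  show "Q_mult x y = Q_mult y x" using x y by (simp add: Q_mult_commute)
  show "Q_mult (Q_mult x y) z = Q_mult x (Q_mult y z)" if "z \<in> Q - convex_subgroups"
    using x y that Q_mult_closed[of x y] Q_mult_closed[of y z]
    by (simp add: Q_mult_eq_set_times mult.assoc)
  obtain a M where M: "M \<in> convex_subgroups" "1 \<notin> M" "a \<noteq> 0" and xM: "x = a *o (1 +o M)"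
    using x by (rule zeroless_cases)
  obtain b N where N: "N \<in> convex_subgroups" "1 \<notin> N" "b \<noteq> 0" and yN: "y = b *o (1 +o N)"
    using y by (rule zeroless_cases)
  have MN: "M + N \<in> convex_subgroups" "1 \<notin> M + N" "a * b \<noteq> 0"
    using convex_subgroups_plus one_notin_plus M N by auto
  have xy: "Q_mult x y = (a * b) *o (1 +o (M + N))" unfolding xM yN by (rule Q_mult_scale_unit[OF M N])
  show "Q_mult x y \<in> Q - convex_subgroups" unfolding xy by (rule scale_unit_in_zeroless[OF MN])
  \<comment> \<open>The last assembly axiom comes from the chain of convex subgroups: the unit of
    the product is \<open>1 +o (M + N)\<close>.\<close>
  have "M + N = M \<or> M + N = N" using convex_subgroups_plus_cases[OF M(1) N(1)] by metis
  thus "assembly_e (Q - convex_subgroups) Q_mult (Q_mult x y) =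
      assembly_e (Q - convex_subgroups) Q_mult x \<or>
      assembly_e (Q - convex_subgroups) Q_mult (Q_mult x y) =
      assembly_e (Q - convex_subgroups) Q_mult y"
    unfolding xy Q_u_scale_unit[OF MN] unfolding xM yN Q_u_scale_unit[OF M] Q_u_scale_unit[OF N]
    by auto
next
  fix x :: "'a set" assume "x \<in> Q - convex_subgroups"
  then obtain a M where M: "M \<in> convex_subgroups" "1 \<notin> M" "a \<noteq> 0" and xM: "x = a *o (1 +o M)"
    by (rule zeroless_cases)
  have "1 +o M \<in> Q - convex_subgroups" using scale_unit_in_zeroless[OF M(1,2) one_neq_zero] by simp
  thus "\<exists>e\<in>Q - convex_subgroups. Q_mult x e = x \<and>
      (\<forall>g\<in>Q - convex_subgroups. Q_mult x g = x \<longrightarrow> Q_mult e g = e)"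
    using Q_mult_neutral[OF M] unfolding xM by blast
  have "1 / a \<noteq> 0" using M(3) by simp
  thus "\<exists>s\<in>Q - convex_subgroups. Q_mult x s = assembly_e (Q - convex_subgroups) Q_mult x \<and>
      assembly_e (Q - convex_subgroups) Q_mult s = assembly_e (Q - convex_subgroups) Q_mult x"
    using Q_mult_inverse[OF M] Q_u_scale_unit[OF M] Q_u_scale_unit[OF M(1,2), of "1 / a"]
      scale_unit_in_zeroless[OF M(1,2), of "1 / a"]
    unfolding xM by blast
qed

section \<open>The formulas for \<open>u\<close> and \<open>d\<close>\<close>

lemma Q_d_scale_unit:
  fixes M :: "'a::linordered_field set"
  assumes M: "M \<in> convex_subgroups" "1 \<notin> M" and a: "a \<noteq> 0"
  shows "assembly_s (Q - convex_subgroups) Q_mult (a *o (1 +o M)) = (1 / a) *o (1 +o M)"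
proof -
  have "1 / a \<noteq> 0" using a by simp
  thus ?thesis
    using scale_unit_in_zeroless[OF M] Q_u_scale_unit[OF M] Q_mult_inverse[OF M a] a
    by (intro assembly.s_eqI[OF Q_mult_assembly]) auto
qed

lemma image_divide_eq_scale:
  fixes c :: "'a::field"
  shows "(\<lambda>x. x / c) ` A = (1 / c) *o A"
  by (auto simp: elt_set_times_def)

lemma Q_u:
  fixes A :: "'a::linordered_field set"
  assumes A: "A \<in> convex_subgroups" "a \<notin> A"
  shows "association_u Q Q_plus Q_mult (a +o A) = 1 +o ((\<lambda>x. x / a) ` A)"
  unfolding association_u_def neutrices_Q image_divide_eq_scale
  using Q_u_scale_unit[OF convex_subgroups_scale[OF A(1)] coset_eq_scale_unit(2,1)[OF A]]
  unfolding coset_eq_scale_unit(3)[OF A, symmetric] .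

text \<open>In normal form \<open>M\<close> is \<open>A / a\<close>, and \<open>1 / a\<close> times
  \<open>1 + A / a\<close> expands to the stated coset.\<close>

lemma Q_d:
  fixes A :: "'a::linordered_field set"
  assumes A: "A \<in> convex_subgroups" "a \<notin> A"
  shows "association_d Q Q_plus Q_mult (a +o A) = (1 / a) +o ((\<lambda>x. x / a\<^sup>2) ` A)"
  unfolding association_d_def neutrices_Q image_divide_eq_scale
  using Q_d_scale_unit[OF convex_subgroups_scale[OF A(1)] coset_eq_scale_unit(2,1)[OF A]]
  unfolding coset_eq_scale_unit(3)[OF A, symmetric]
  by (simp add: scale_coset set_times_rearrange2 power2_eq_square)

section \<open>The association\<close>

text \<open>Both sides have the representative \<open>a * b + a * c\<close>, so only the subgroups
  must be compared. Cancellation in \<open>b + c\<close> may make \<open>(b + c) *o A\<close> too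
  small; the correction terms restore \<open>b *o A\<close> and \<open>c *o A\<close>.\<close>

lemma Q_distrib:
  fixes x y z :: "'a::linordered_field set"
  assumes "x \<in> Q" "y \<in> Q" "z \<in> Q"
  shows "Q_plus (Q_mult x y) (Q_mult x z) =
    Q_plus (Q_plus (Q_mult x (Q_plus y z)) (Q_mult (assembly_e Q Q_plus x) y))
      (Q_mult (assembly_e Q Q_plus x) z)"
proof -
  obtain a A where A: "A \<in> convex_subgroups" "x = a +o A" using assms(1) by (rule Q_cases)
  obtain b B where B: "B \<in> convex_subgroups" "y = b +o B" using assms(2) by (rule Q_cases)
  obtain c C where C: "C \<in> convex_subgroups" "z = c +o C" using assms(3) by (rule Q_cases)
  note cs = A(1) B(1) C(1) convex_subgroups_plus convex_subgroups_times convex_subgroups_scale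
  have "(b + c) *o A \<subseteq> b *o A + c *o A"
    by (auto simp: elt_set_times_def distrib_right intro!: set_plus_intro)
  hence sum: "(b + c) *o A + (b *o A + c *o A) = b *o A + c *o A"
    by (intro convex_subgroups_plus_absorb cs)
  have idem: "N + N = N" if "N \<in> convex_subgroups" for N :: "'a set"
    using that by (simp add: convex_subgroups_plus_absorb)
  have "(a *o (B + C) + (b + c) *o A + A * (B + C)) + (b *o A + A * B) + (c *o A + A * C)
      = (a *o B + a *o C) + ((b + c) *o A + (b *o A + c *o A)) + (A * B + A * B) + (A * C + A * C)"
    by (simp add: convex_subgroups_distrib[OF A(1) B(1) C(1)] set_times_plus_distribs ac_simps)
  also have "\<dots> = (a *o B + b *o A + A * B) + (a *o C + c *o A + A * C)"
    unfolding sum idem[OF convex_subgroups_times[OF A(1) B(1)]]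
      idem[OF convex_subgroups_times[OF A(1) C(1)]]
    by (simp add: ac_simps)
  finally have N: "(a *o (B + C) + (b + c) *o A + A * (B + C)) + (b *o A + A * B) + (c *o A + A * C)
      = (a *o B + b *o A + A * B) + (a *o C + c *o A + A * C)" .
  \<comment> \<open>The explicit representative 0 lets \<open>Q_plus_eq\<close> apply to the
    correction terms.\<close>
  have e: "Q_mult A (b +o B) = 0 +o (b *o A + A * B)" "Q_mult A (c +o C) = 0 +o (c *o A + A * C)"
    using subgroup_times_coset[OF A(1) B(1)] subgroup_times_coset[OF A(1) C(1)] by simp_all
  show ?thesis
    unfolding A(2) B(2) C(2) Q_e[OF A(1)] e
    by (simp only: Q_plus_eq Q_mult_eq cs N distrib_left add_0_right)
qed

lemma Q_e_mult_is_e: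
  assumes "x \<in> Q" "y \<in> Q"
  shows "\<exists>w\<in>Q. Q_mult (assembly_e Q Q_plus x) y = assembly_e Q Q_plus w"
proof -
  obtain a A where A: "A \<in> convex_subgroups" "x = a +o A" using assms(1) by (rule Q_cases)
  obtain b B where B: "B \<in> convex_subgroups" "y = b +o B" using assms(2) by (rule Q_cases)
  have "b *o A + A * B \<in> convex_subgroups"
    using A B by (intro convex_subgroups_plus convex_subgroups_scale convex_subgroups_times)
  thus ?thesis unfolding A(2) B(2) Q_e[OF A(1)] subgroup_times_coset[OF A(1) B(1)]
    using Q_e_subgroup convex_subgroups_in_Q by blast
qed

lemma Q_e_mult:
  assumes "x \<in> Q" "y \<in> Q"
  shows "assembly_e Q Q_plus (Q_mult x y) =
    Q_plus (Q_mult (assembly_e Q Q_plus x) y) (Q_mult (assembly_e Q Q_plus y) x)"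
proof -
  obtain a A where A: "A \<in> convex_subgroups" "x = a +o A" using assms(1) by (rule Q_cases)
  obtain b B where B: "B \<in> convex_subgroups" "y = b +o B" using assms(2) by (rule Q_cases)
  note cs = convex_subgroups_plus convex_subgroups_scale convex_subgroups_times A(1) B(1)
  \<comment> \<open>Each of the two products on the right contributes a copy of
    \<open>A * B\<close>; they merge by idempotence.\<close>
  have "A * B + A * B = A * B" by (intro convex_subgroups_plus_absorb cs order_refl)
  moreover have "(b *o A + A * B) + (a *o B + B * A) = a *o B + b *o A + (A * B + A * B)"
    by (simp only: ac_simps)
  ultimately have "a *o B + b *o A + A * B = (b *o A + A * B) + (a *o B + B * A)" by simp
  thus ?thesis
    unfolding A(2) B(2) Q_e[OF A(1)] Q_e[OF B(1)] subgroup_times_coset[OF A(1) B(1)]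
      subgroup_times_coset[OF B(1) A(1)] Q_mult_eq[OF A(1) B(1)]
    by (simp add: Q_plus_eq_set_plus Q_e convex_subgroups_in_Q cs)
qed

text \<open>The product \<open>A * d(x)\<close> is \<open>A / a\<close> plus \<open>A\<close> times
  \<open>A / a^2\<close>. The latter is absorbed: \<open>s / a\<close> is bounded for
  \<open>s \<in> A\<close>, so \<open>s / a * t\<close> stays in \<open>A\<close>.\<close>

lemma Q_e_u:
  fixes x :: "'a::linordered_field set"
  assumes "x \<in> Q" "x \<noteq> assembly_e Q Q_plus x"
  shows "assembly_e Q Q_plus (association_u Q Q_plus Q_mult x) =
    Q_mult (assembly_e Q Q_plus x) (association_d Q Q_plus Q_mult x)"
proof -
  obtain a A where A: "A \<in> convex_subgroups" "x = a +o A" using assms(1) by (rule Q_cases)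
  have aA: "a \<notin> A" using assms(2) A by (simp add: Q_e coset_eq_subgroup_iff)
  hence a: "a \<noteq> 0" using convex_subgroupsD(1)[OF A(1)] by auto
  have "A * ((1 / a\<^sup>2) *o A) \<subseteq> (1 / a) *o A"
  proof
    fix v assume "v \<in> A * ((1 / a\<^sup>2) *o A)"
    then obtain s t where st: "s \<in> A" "t \<in> A" "v = s * (1 / a\<^sup>2 * t)"
      by (auto simp: set_times_def elt_set_times_def)
    have "\<bar>s / a\<bar> \<le> 2" using abs_less_of_notin(1)[OF A(1) aA st(1)] a by (simp add: abs_divide divide_simps)
    hence "s / a * t \<in> A" using st by (intro convex_subgroups_mult_bounded[OF A(1)])
    moreover have "v / (1 / a) = s / a * t" using st a by (simp add: power2_eq_square)
    ultimately show "v \<in> (1 / a) *o A" using a by (simp add: mem_scale_iff)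
  qed
  hence "(1 / a) *o A + A * ((1 / a\<^sup>2) *o A) = (1 / a) *o A"
    by (intro convex_subgroups_plus_absorb convex_subgroups_times convex_subgroups_scale A)
  thus ?thesis
    unfolding A(2) Q_u[OF A(1) aA] Q_d[OF A(1) aA] Q_e[OF A(1)] image_divide_eq_scale
    using A(1) by (simp add: Q_e subgroup_times_coset convex_subgroups_scale)
qed

lemma Q_s_mult:
  assumes "x \<in> Q" "y \<in> Q"
  shows "assembly_s Q Q_plus (Q_mult x y) = Q_mult (assembly_s Q Q_plus x) y"
proof -
  obtain a A where A: "A \<in> convex_subgroups" "x = a +o A" using assms(1) by (rule Q_cases)
  obtain b B where B: "B \<in> convex_subgroups" "y = b +o B" using assms(2) by (rule Q_cases)
  note cs = convex_subgroups_plus convex_subgroups_scale convex_subgroups_times A(1) B(1)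
  \<comment> \<open>Subgroups are symmetric, so the sign changes only the representative.\<close>
  have "(- a) *o B = a *o B"
  proof -
    have "c *o B \<subseteq> (- c) *o B" for c
      using convex_subgroupsD(3)[OF B(1)] by (force simp: elt_set_times_def)
    from this[of a] this[of "- a"] show ?thesis by simp
  qed
  thus ?thesis unfolding A(2) B(2) Q_s[OF A(1)] by (simp add: Q_mult_eq Q_s cs)
qed

lemma Q_association: "association (Q :: 'a::linordered_field set set) Q_plus Q_mult"
proof (rule association.intro)
  show "assembly (Q - neutrices Q Q_plus :: 'a set set) Q_mult"
    unfolding neutrices_Q by (rule Q_mult_assembly)
qed (fact Q_plus_assembly Q_mult_closed Q_distrib Q_e_mult_is_e Q_e_mult Q_e_u Q_s_mult)+

section \<open>The order\<close>

lemma Q_le_antisym: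
  fixes x y :: "'a::linordered_field set"
  assumes "x \<in> Q" "y \<in> Q" "Q_le x y" "Q_le y x"
  shows "x = y"
proof -
  have sub: "B \<subseteq> A"
    if A: "A \<in> convex_subgroups" and B: "B \<in> convex_subgroups"
      and le: "Q_le (a +o A) (b +o B)" "Q_le (b +o B) (a +o A)" for a b :: 'a and A B
  proof
    fix t assume t: "t \<in> B"
    have "a + 0 \<in> a +o A" using convex_subgroupsD(1)[OF A] by (rule set_plus_intro2)
    then obtain t' where t': "t' \<in> B" "a \<le> b + t'"
      using le(1) by (auto simp: Q_le_def elt_set_plus_def)
    \<comment> \<open>The summand \<open>\<bar>t'\<bar>\<close> lifts \<open>b\<close> to at least
      \<open>a\<close>. An \<open>a + s\<close> above
      \<open>b + (\<bar>t\<bar> + \<bar>t'\<bar>)\<close> therefore has \<open>s\<close> at least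
      \<open>\<bar>t\<bar>\<close>.\<close>
    have "\<bar>t\<bar> + \<bar>t'\<bar> \<in> B"
      using t t' convex_subgroupsD(4)[OF B, of _ "\<bar>_\<bar>"] by (intro convex_subgroupsD(2)[OF B]) auto
    then obtain s where s: "s \<in> A" "b + (\<bar>t\<bar> + \<bar>t'\<bar>) \<le> a + s"
      using le(2) by (auto simp: Q_le_def elt_set_plus_def)
    hence "\<bar>t\<bar> \<le> \<bar>s\<bar>" using t'(2) by linarith
    thus "t \<in> A" using convex_subgroupsD(4)[OF A s(1)] by blast
  qed
  obtain a A where A: "A \<in> convex_subgroups" "x = a +o A" using assms(1) by (rule Q_cases)
  obtain b B where B: "B \<in> convex_subgroups" "y = b +o B" using assms(2) by (rule Q_cases)
  have AB: "A = B" using sub[OF A(1) B(1)] sub[OF B(1) A(1)] A(2) B(2) assms(3,4) by blast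
  have "a \<in> x" "b \<in> y"
    using convex_subgroupsD(1)[OF A(1)] convex_subgroupsD(1)[OF B(1)] A(2) B(2)
    by (simp_all add: mem_coset_iff)
  then obtain v w where vw: "v \<in> y" "a \<le> v" "w \<in> x" "b \<le> w"
    using assms(3,4) unfolding Q_le_def by blast
  hence "v - b \<in> A" "w - a \<in> A" using A(2) B(2) AB by (simp_all add: mem_coset_iff)
  \<comment> \<open>The difference of the representatives is trapped between two elements of the
    common subgroup.\<close>
  moreover have "- (v - b) \<le> b - a" "b - a \<le> w - a" using vw by simp_all
  ultimately have "b - a \<in> A" using convex_subgroups_between[OF A(1)] convex_subgroupsD(3)[OF A(1)] by blast
  thus ?thesis using A B AB coset_eqI by metis
qed

section \<open>Compatibility of the order with the operations\<close>

lemma Q_le_of_subset: "x \<subseteq> y \<Longrightarrow> Q_le x y"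
  unfolding Q_le_def by blast

lemma Q_add_mono:
  fixes x y z :: "'a::linordered_field set"
  assumes "x \<in> Q" "y \<in> Q" "z \<in> Q" "Q_le x y"
  shows "Q_le (Q_plus x z) (Q_plus y z)"
  unfolding Q_plus_eq_set_plus[OF assms(1,3)] Q_plus_eq_set_plus[OF assms(2,3)] Q_le_def
proof
  fix p assume "p \<in> x + z"
  then obtain v w where vw: "v \<in> x" "w \<in> z" "p = v + w" by (auto simp: set_plus_def)
  then obtain v' where "v' \<in> y" "v \<le> v'" using assms(4) by (auto simp: Q_le_def)
  thus "\<exists>q\<in>y + z. p \<le> q" using vw by (intro bexI[of _ "v' + w"]) auto
qed

text \<open>Absorption by \<open>A\<close> means that \<open>b +o B\<close> is a subset of
  \<open>A\<close>, and then so is its symmetric element; inclusion implies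
  \<open>Q_le\<close>.\<close>

lemma Q_absorbed_le:
  fixes x y :: "'a::linordered_field set"
  assumes "x \<in> Q" "y \<in> Q" "Q_plus y (assembly_e Q Q_plus x) = assembly_e Q Q_plus x"
  shows "Q_le y (assembly_e Q Q_plus x) \<and> Q_le (assembly_s Q Q_plus y) (assembly_e Q Q_plus x)"
proof -
  obtain a A where A: "A \<in> convex_subgroups" "x = a +o A" using assms(1) by (rule Q_cases)
  obtain b B where B: "B \<in> convex_subgroups" "y = b +o B" using assms(2) by (rule Q_cases)
  have "Q_plus (0 +o A) (b +o B) = 0 +o A"
    using assms(3) unfolding A(2) B(2) Q_e[OF A(1)]
    by (simp add: Q_plus_eq_set_plus convex_subgroups_in_Q coset_in_Q A(1) B(1) add.commute)
  hence "B \<subseteq> A" "b \<in> A" using Q_plus_eq_self_iff[OF A(1) B(1), of 0 b] by auto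
  moreover have "c +o B \<subseteq> A" if "B \<subseteq> A" "c \<in> A" for c
    using that convex_subgroupsD(2)[OF A(1)] by (auto simp: elt_set_plus_def)
  ultimately show ?thesis
    unfolding A(2) B(2) Q_e[OF A(1)] Q_s[OF B(1)]
    using convex_subgroupsD(3)[OF A(1)] Q_le_of_subset by blast
qed

lemma Q_mult_mono:
  fixes x y z :: "'a::linordered_field set"
  assumes "x \<in> Q" "y \<in> Q" "z \<in> Q" "Q_le (assembly_e Q Q_plus x) x" "assembly_e Q Q_plus x \<noteq> x"
    and "Q_le y z"
  shows "Q_le (Q_mult x y) (Q_mult x z)"
proof -
  obtain a A where A: "A \<in> convex_subgroups" "x = a +o A" using assms(1) by (rule Q_cases)
  have aA: "a \<notin> A" using assms(5)[symmetric] A by (simp add: Q_e coset_eq_subgroup_iff)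
  have "Q_le A (a +o A)" using assms(4) A by (simp add: Q_e)
  then obtain s0 where s0: "s0 \<in> A" "0 \<le> a + s0"
    using convex_subgroupsD(1)[OF A(1)] by (auto simp: Q_le_def elt_set_plus_def)
  \<comment> \<open>Since \<open>a\<close> exceeds every element of \<open>A\<close> in absolute
    value, all \<open>a + s\<close> share the sign of \<open>a\<close>; the element
    \<open>a + s0\<close> shows that it is positive.\<close>
  have pos: "0 < a + s" if s: "s \<in> A" for s
    using abs_less_of_notin(1)[OF A(1) aA s] abs_less_of_notin(1)[OF A(1) aA s0(1)] s0(2) by linarith
  show ?thesis
    unfolding Q_mult_eq_set_times[OF assms(1,2)] Q_mult_eq_set_times[OF assms(1,3)] Q_le_def
  proof
    fix p assume "p \<in> x * y"
    then obtain v w where vw: "v \<in> x" "w \<in> y" "p = v * w" by (auto simp: set_times_def)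
    then obtain w' where w': "w' \<in> z" "w \<le> w'" using assms(6) by (auto simp: Q_le_def)
    have "0 < v" using vw(1) A(2) pos by (auto simp: elt_set_plus_def)
    hence "p \<le> v * w'" using vw w' by (simp add: mult_left_mono)
    thus "\<exists>q\<in>x * z. p \<le> q" using vw w' by (intro bexI[of _ "v * w'"]) auto
  qed
qed

lemma Q_e_mult_mono:
  fixes x y z :: "'a::linordered_field set"
  assumes "x \<in> Q" "y \<in> Q" "z \<in> Q" "Q_le (assembly_e Q Q_plus y) y" "Q_le y z"
  shows "Q_le (Q_mult (assembly_e Q Q_plus x) y) (Q_mult (assembly_e Q Q_plus x) z)"
proof -
  obtain a A where A: "A \<in> convex_subgroups" "x = a +o A" using assms(1) by (rule Q_cases)
  obtain b B where B: "B \<in> convex_subgroups" "y = b +o B" using assms(2) by (rule Q_cases)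
  have "Q_le B (b +o B)" using assms(4) B by (simp add: Q_e)
  then obtain t0 where t0: "t0 \<in> B" "0 \<le> b + t0"
    using convex_subgroupsD(1)[OF B(1)] by (auto simp: Q_le_def elt_set_plus_def)
  have "Q_le (A * y) (A * z)"
    unfolding Q_le_def
  proof
    fix p assume "p \<in> A * y"
    then obtain s t where st: "s \<in> A" "t \<in> B" "p = s * (b + t)"
      unfolding B(2) by (auto simp: set_times_def elt_set_plus_def)
    \<comment> \<open>An element of \<open>A\<close> may be negative, so \<open>b + t\<close> must
      be dominated in absolute value. As \<open>b + t0\<close> is nonnegative,
      \<open>b + (t0 + \<bar>t - t0\<bar>)\<close> bounds both \<open>b + t\<close> and its
      negative.\<close>
    have "\<bar>t - t0\<bar> \<in> B"
      using convex_subgroupsD(4)[OF B(1) convex_subgroups_diff[OF B(1) st(2) t0(1)], of "\<bar>t - t0\<bar>"] by simp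
    hence "b + (t0 + \<bar>t - t0\<bar>) \<in> y"
      unfolding B(2) using t0(1) convex_subgroupsD(2)[OF B(1)] by (blast intro: set_plus_intro2)
    then obtain w where w: "w \<in> z" "b + (t0 + \<bar>t - t0\<bar>) \<le> w" using assms(5) by (auto simp: Q_le_def)
    have "\<bar>b + t\<bar> \<le> w" using w(2) t0(2) by linarith
    hence "\<bar>s\<bar> * \<bar>b + t\<bar> \<le> \<bar>s\<bar> * w" by (simp add: mult_left_mono)
    hence "p \<le> \<bar>s\<bar> * w" unfolding st(3) by (metis abs_ge_self abs_mult order_trans)
    moreover have "\<bar>s\<bar> \<in> A" using convex_subgroupsD(4)[OF A(1) st(1), of "\<bar>s\<bar>"] by simp
    ultimately show "\<exists>q\<in>A * z. p \<le> q" using w by (intro bexI[of _ "\<bar>s\<bar> * w"]) auto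
  qed
  thus ?thesis
    unfolding A(2) Q_e[OF A(1)]
    using assms(2,3) convex_subgroups_in_Q[OF A(1)] by (simp add: Q_mult_eq_set_times)
qed

lemma Q_ordered_association:
  "ordered_association (Q :: 'a::linordered_field set set) Q_plus Q_mult Q_le"
proof (intro ordered_association.intro ordered_association_axioms.intro)
  show "association (Q :: 'a set set) Q_plus Q_mult" by (rule Q_association)
  show "reflp_on (Q :: 'a set set) Q_le" by (auto intro!: reflp_onI simp: Q_le_def)
  show "transp_on (Q :: 'a set set) Q_le"
    by (rule transp_onI) (unfold Q_le_def, meson order_trans)
  show "antisymp_on (Q :: 'a set set) Q_le" by (rule antisymp_onI) (rule Q_le_antisym)
  \<comment> \<open>If \<open>x\<close> is not below \<open>y\<close>, some element of
    \<open>x\<close> exceeds all elements of \<open>y\<close>, which puts \<open>y\<close> below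
    \<open>x\<close>.\<close>
  show "totalp_on (Q :: 'a set set) Q_le"
    by (rule totalp_onI) (unfold Q_le_def, meson linear)
qed (fact Q_add_mono Q_absorbed_le Q_mult_mono Q_e_mult_mono)+

theorem theorem4p8:
  assumes non_archimedean: "\<not> (\<forall>x::'a::linordered_field. \<exists>n::nat. x \<le> of_nat n)"
  shows "ordered_association (Q :: 'a set set) Q_plus Q_mult Q_le \<and>
    (\<forall>a::'a. \<forall>A\<in>convex_subgroups.
       assembly_e Q Q_plus (a +o A) = A \<and>
       assembly_s Q Q_plus (a +o A) = (- a) +o A \<and>
       (a +o A \<notin> convex_subgroups \<longrightarrow>
          association_u Q Q_plus Q_mult (a +o A) = 1 +o ((\<lambda>x. x / a) ` A) \<and>
          association_d Q Q_plus Q_mult (a +o A) = (1 / a) +o ((\<lambda>x. x / a\<^sup>2) ` A)))"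
  \<comment> \<open>The rule \<open>coset_in_convex_subgroups_iff\<close> turns the side condition
    into \<open>a \<notin> A\<close>, the form expected by \<open>Q_u\<close> and
    \<open>Q_d\<close>.\<close>
  by (simp add: Q_ordered_association Q_e Q_s Q_u Q_d coset_in_convex_subgroups_iff)

end
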